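(* Let $!_{a}$ be Bhargava's factorial function of the set of prime numbers, given by $0!_{a}=1$ and, for $n\ge1$, $$n!_{a}=\prod_{p}p^{\sum_{m=0}^{\infty}\left\lfloor\frac{n-1}{p^m(p-1)}\right\rfloor},$$ where the (in effect finite) product extends over all primes $p$. Then the number $e_{a}=\sum_{n=0}^{\infty}\frac{1}{n!_{a}}$ (whose approximate numerical value is $2.562760934$) is irrational.
   Context: $\lfloor x\rfloor$ denotes the greatest integer not exceeding $x$. *)

theory Defs
  imports Complex_Main "HOL-Computational_Algebra.Primes"
begin

text \<open>For \<open>n \<ge> 1\<close> and \<open>p\<close> prime, only finitely many terms of the following series are
  nonzero (lemma \<open>bh_exponent_finite\<close>), so that \<^const>\<open>suminf\<close> on \<^typ>\<open>nat\<close> is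
  meaningful and \<^const>\<open>nat\<close> does not truncate anything.\<close>

definition bh_exponent :: "nat \<Rightarrow> nat \<Rightarrow> nat" where
  "bh_exponent n p = (\<Sum>m. nat \<lfloor>(real n - 1) / (real p ^ m * (real p - 1))\<rfloor>)"

text \<open>The product over all primes is taken over the primes whose factor differs from 1; there are
  finitely many of them (lemma \<open>bh_primes_finite\<close>).\<close>

definition bh_fact :: "nat \<Rightarrow> nat" where
  "bh_fact n = (if n = 0 then 1
     else (\<Prod>p \<in> {p. prime p \<and> bh_exponent n p \<noteq> 0}. p ^ bh_exponent n p))"

definition bh_e :: real where
  "bh_e = (\<Sum>n. 1 / real (bh_fact n))"

lemma bh_term_eq:
  assumes "n \<ge> 1" "prime p"
  shows "nat \<lfloor>(real n - 1) / (real p ^ m * (real p - 1))\<rfloor> = (n - 1) div (p ^ m * (p - 1))"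
proof -
  have "p \<ge> 1" using assms(2) prime_ge_1_nat by blast
  then have "(real n - 1) / (real p ^ m * (real p - 1)) = real (n - 1) / real (p ^ m * (p - 1))"
    using assms(1) by (simp add: of_nat_diff)
  then show ?thesis
    by (simp only: floor_divide_of_nat_eq nat_int)
qed

lemma bh_term_zero:
  assumes "n \<ge> 1" "prime p" "m \<ge> n \<or> p > n"
  shows "(n - 1) div (p ^ m * (p - 1)) = 0"
proof -
  have p2: "p \<ge> 2" using assms(2) prime_ge_2_nat by blast
  have pm: "p ^ m \<ge> 1" using p2 by simp
  have "n - 1 < p ^ m * (p - 1)"
    using assms(3)
  proof
    assume "m \<ge> n"
    have "m < p ^ m" using p2 by (intro power_gt_expt) simp
    then have "n - 1 < p ^ m" using \<open>m \<ge> n\<close> by linarith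
    also have "p ^ m \<le> p ^ m * (p - 1)" using p2 by simp
    finally show ?thesis .
  next
    assume "p > n"
    then have "n - 1 < p - 1" using assms(1) by linarith
    also have "p - 1 \<le> p ^ m * (p - 1)" using pm by simp
    finally show ?thesis .
  qed
  then show ?thesis by simp
qed

lemma bh_term_nonzero:
  assumes "n \<ge> 1" "prime p" "(n - 1) div (p ^ m * (p - 1)) \<noteq> 0"
  shows "m < n" "p \<le> n"
  using bh_term_zero[OF assms(1,2), of m] assms(3) by linarith+

lemma bh_exponent_finite:
  assumes "n \<ge> 1" "prime p"
  shows "finite {m. nat \<lfloor>(real n - 1) / (real p ^ m * (real p - 1))\<rfloor> \<noteq> 0}"
proof (rule finite_subset)
  show "{m. nat \<lfloor>(real n - 1) / (real p ^ m * (real p - 1))\<rfloor> \<noteq> 0} \<subseteq> {..<n}"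
    unfolding bh_term_eq[OF assms] using bh_term_nonzero(1)[OF assms] by blast
qed simp

lemma bh_exponent_eq:
  assumes "n \<ge> 1" "prime p"
  shows "bh_exponent n p = (\<Sum>m<n. (n - 1) div (p ^ m * (p - 1)))"
  unfolding bh_exponent_def bh_term_eq[OF assms]
  using bh_term_nonzero(1)[OF assms] by (intro suminf_finite) blast+

lemma bh_exponent_eq_0:
  assumes "n \<ge> 1" "prime p" "p > n"
  shows "bh_exponent n p = 0"
  unfolding bh_exponent_eq[OF assms(1,2)] using bh_term_zero assms by simp

lemma bh_exponent_nonzero:
  assumes "n \<ge> 1" "prime p" "bh_exponent n p \<noteq> 0"
  shows "p \<in> {..n}"
  using bh_exponent_eq_0[OF assms(1,2)] assms(3) by (cases "p > n") auto

lemma bh_primes_finite: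
  assumes "n \<ge> 1"
  shows "finite {p. prime p \<and> bh_exponent n p \<noteq> 0}"
proof (rule finite_subset)
  show "{p. prime p \<and> bh_exponent n p \<noteq> 0} \<subseteq> {..n}"
    using bh_exponent_nonzero[OF assms] by blast
qed simp

lemma bh_fact_eq:
  assumes "n \<ge> 1" "n \<le> N"
  shows "bh_fact n = (\<Prod>p \<in> {p \<in> {..N}. prime p}. p ^ bh_exponent n p)"
proof -
  have "bh_fact n = (\<Prod>p \<in> {p. prime p \<and> bh_exponent n p \<noteq> 0}. p ^ bh_exponent n p)"
    using assms by (simp add: bh_fact_def)
  also have "\<dots> = (\<Prod>p \<in> {p \<in> {..N}. prime p}. p ^ bh_exponent n p)"
  proof (rule prod.mono_neutral_left)
    show "{p. prime p \<and> bh_exponent n p \<noteq> 0} \<subseteq> {p \<in> {..N}. prime p}"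
      using bh_exponent_nonzero[OF assms(1)] assms(2) order_trans by blast
  qed auto
  finally show ?thesis .
qed

lemma bh_fact_pos: "bh_fact n > 0"
  by (auto simp: bh_fact_def intro!: prod_pos dest: prime_gt_0_nat)

lemma bh_exponent_mono:
  assumes "n \<ge> 1" "prime p"
  shows "bh_exponent n p \<le> bh_exponent (Suc n) p"
proof -
  have "Suc n \<ge> 1" by simp
  have "bh_exponent n p = (\<Sum>m<n. (n - 1) div (p ^ m * (p - 1)))"
    by (rule bh_exponent_eq[OF assms])
  also have "\<dots> \<le> (\<Sum>m<n. (Suc n - 1) div (p ^ m * (p - 1)))"
    by (intro sum_mono div_le_mono) simp
  also have "\<dots> \<le> (\<Sum>m<Suc n. (Suc n - 1) div (p ^ m * (p - 1)))"
    by (intro sum_mono2) auto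
  also have "\<dots> = bh_exponent (Suc n) p"
    by (rule bh_exponent_eq[symmetric, OF \<open>Suc n \<ge> 1\<close> assms(2)])
  finally show ?thesis .
qed

lemma bh_exponent_2:
  assumes "n \<ge> 1"
  shows "bh_exponent n 2 + 1 \<le> bh_exponent (Suc n) 2"
proof -
  have s: "{..<n} = insert 0 {1..<n}" using assms by auto
  have "bh_exponent n 2 + 1 = (\<Sum>m<n. (n - 1) div 2 ^ m) + 1"
    using bh_exponent_eq[of n 2] assms by simp
  also have "\<dots> = n + (\<Sum>m\<in>{1..<n}. (n - 1) div 2 ^ m)"
    unfolding s using assms by simp
  also have "\<dots> \<le> n + (\<Sum>m\<in>{1..<n}. n div 2 ^ m)"
    by (intro add_left_mono sum_mono div_le_mono) simp
  also have "\<dots> = (\<Sum>m<n. n div 2 ^ m)"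
    unfolding s by simp
  also have "\<dots> \<le> (\<Sum>m<Suc n. n div 2 ^ m)"
    by (intro sum_mono2) auto
  also have "\<dots> = bh_exponent (Suc n) 2"
    using bh_exponent_eq[of "Suc n" 2] by simp
  finally show ?thesis .
qed

lemma bh_fact_double:
  assumes "n \<ge> 1"
  shows "2 * bh_fact n \<le> bh_fact (Suc n)"
proof -
  define P where "P = {p \<in> {..Suc n}. prime p} - {2::nat}"
  have P: "{p \<in> {..Suc n}. prime p} = insert 2 P" "2 \<notin> P" "finite P"
    using assms by (auto simp: P_def)
  have "2 * bh_fact n = 2 ^ (bh_exponent n 2 + 1) * (\<Prod>p\<in>P. p ^ bh_exponent n p)"
    using bh_fact_eq[OF assms, of "Suc n"] P by simp
  also have "\<dots> \<le> 2 ^ bh_exponent (Suc n) 2 * (\<Prod>p\<in>P. p ^ bh_exponent (Suc n) p)"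
  proof (intro mult_mono prod_mono)
    show "(2::nat) ^ (bh_exponent n 2 + 1) \<le> 2 ^ bh_exponent (Suc n) 2"
      using bh_exponent_2[OF assms] by (intro power_increasing) auto
  next
    fix p assume "p \<in> P"
    then have "prime p" by (auto simp: P_def)
    then show "0 \<le> p ^ bh_exponent n p \<and> p ^ bh_exponent n p \<le> p ^ bh_exponent (Suc n) p"
      using bh_exponent_mono[OF assms] prime_ge_1_nat by (auto intro!: power_increasing)
  qed auto
  also have "\<dots> = bh_fact (Suc n)"
    using bh_fact_eq[of "Suc n" "Suc n"] P by simp
  finally show ?thesis .
qed

lemma bh_fact_growth:
  assumes "n \<ge> 1"
  shows "2 ^ k * bh_fact n \<le> bh_fact (n + k)"
proof (induction k)
  case (Suc k)
  have "2 ^ Suc k * bh_fact n \<le> 2 * bh_fact (n + k)" using Suc by simp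
  also have "\<dots> \<le> bh_fact (n + Suc k)" using bh_fact_double[of "n + k"] assms by simp
  finally show ?case .
qed simp

lemma bh_term_le:
  assumes "n \<ge> 1"
  shows "1 / real (bh_fact (k + n)) \<le> 1 / real (bh_fact n) * (1 / 2) ^ k"
proof -
  have "2 ^ k * real (bh_fact n) \<le> real (bh_fact (k + n))"
    using bh_fact_growth[OF assms, of k]
    by (metis add.commute of_nat_le_iff of_nat_mult of_nat_numeral of_nat_power)
  then have "1 / real (bh_fact (k + n)) \<le> 1 / (2 ^ k * real (bh_fact n))"
    using bh_fact_pos[of n] bh_fact_pos[of "k + n"] by (intro divide_left_mono) auto
  then show ?thesis by (simp add: power_one_over field_simps)
qed

lemma bh_e_summable: "summable (\<lambda>n. 1 / real (bh_fact n))"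
proof -
  have "summable (\<lambda>k. 1 / real (bh_fact (k + 1)))"
  proof (rule summable_comparison_test')
    show "summable (\<lambda>k. 1 / real (bh_fact 1) * (1 / 2) ^ k)"
      by (intro summable_mult summable_geometric) simp
    show "norm (1 / real (bh_fact (k + 1))) \<le> 1 / real (bh_fact 1) * (1 / 2) ^ k" if "k \<ge> 0" for k
      using bh_term_le[of 1 k] by simp
  qed
  then show ?thesis using summable_iff_shift[of "\<lambda>n. 1 / real (bh_fact n)" 1] by blast
qed

lemma bh_primes_11: "{p \<in> {..11}. prime p} = {2, 3, 5, 7, 11::nat}"
proof -
  have "{..11::nat} = {0, 1, 2, 3, 4, 5, 6, 7, 8, 9, 10, 11}"
    unfolding set_eq_iff atMost_iff insert_iff empty_iff by presburger
  moreover have "prime (2::nat)" "prime (3::nat)" "prime (5::nat)" "prime (7::nat)"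
    "prime (11::nat)" "\<not> prime (4::nat)" "\<not> prime (6::nat)" "\<not> prime (8::nat)"
    "\<not> prime (9::nat)" "\<not> prime (10::nat)"
    by simp_all
  ultimately show ?thesis by auto
qed

lemma bh_fact_values:
  "bh_fact 0 = 1" "bh_fact 1 = 1" "bh_fact 2 = 2" "bh_fact 3 = 24" "bh_fact 4 = 48"
  "bh_fact 5 = 5760" "bh_fact 6 = 11520" "bh_fact 7 = 2903040" "bh_fact 8 = 5806080"
  "bh_fact 9 = 1393459200" "bh_fact 10 = 2786918400" "bh_fact 11 = 367873228800"
proof -
  have ex: "bh_exponent n p = (n - 1) div (p - 1) + (n - 1) div (p * (p - 1))
      + (n - 1) div (p ^ 2 * (p - 1)) + (n - 1) div (p ^ 3 * (p - 1))"
    if n: "n \<ge> 1" "n \<le> 11" and p: "p \<in> {2, 3, 5, 7, 11}" for n p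
  proof -
    have pp: "prime p" using p bh_primes_11 by blast
    have p2: "p \<ge> 2" using prime_ge_2_nat[OF pp] .
    have z: "(n - 1) div (p ^ m * (p - 1)) = 0" if "m \<notin> {..<4}" for m
    proof -
      have "(16::nat) = 2 ^ 4" by simp
      also have "\<dots> \<le> 2 ^ m" using that by (intro power_increasing) auto
      also have "\<dots> \<le> p ^ m" using p2 by (intro power_mono) auto
      also have "\<dots> \<le> p ^ m * (p - 1)" using p2 by simp
      finally have "n - 1 < p ^ m * (p - 1)" using n by linarith
      then show ?thesis by simp
    qed
    have "bh_exponent n p = (\<Sum>m<4. (n - 1) div (p ^ m * (p - 1)))"
      unfolding bh_exponent_def bh_term_eq[OF n(1) pp]
      by (rule suminf_finite[OF finite_lessThan z])
    moreover have "{..<4::nat} = {0, 1, 2, 3}"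
      unfolding set_eq_iff lessThan_iff insert_iff empty_iff by presburger
    ultimately show ?thesis by (simp only:) simp
  qed
  have fa: "bh_fact n = 2 ^ bh_exponent n 2 * 3 ^ bh_exponent n 3 * 5 ^ bh_exponent n 5
      * 7 ^ bh_exponent n 7 * 11 ^ bh_exponent n 11" if "n \<ge> 1" "n \<le> 11" for n
    unfolding bh_fact_eq[OF that] bh_primes_11 by simp
  show "bh_fact 0 = 1" by (simp add: bh_fact_def)
  show "bh_fact 1 = 1" "bh_fact 2 = 2" "bh_fact 3 = 24" "bh_fact 4 = 48"
    "bh_fact 5 = 5760" "bh_fact 6 = 11520" "bh_fact 7 = 2903040" "bh_fact 8 = 5806080"
    "bh_fact 9 = 1393459200" "bh_fact 10 = 2786918400" "bh_fact 11 = 367873228800"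
    by (simp_all add: fa ex)
qed

lemma bh_e_approx: "\<bar>bh_e - 2.562760934\<bar> < 5 / 10 ^ 10"
proof -
  let ?f = "\<lambda>n. 1 / real (bh_fact n)"
  have split: "bh_e = (\<Sum>k. ?f (k + 11)) + (\<Sum>n<11. ?f n)"
    unfolding bh_e_def by (rule suminf_split_initial_segment[OF bh_e_summable])
  have sm: "summable (\<lambda>k. ?f (k + 11))"
    using bh_e_summable by (simp only: summable_iff_shift[of ?f 11])
  have geo: "(\<lambda>k. ?f 11 * (1 / 2) ^ k) sums (?f 11 * 2)"
    using sums_mult[OF geometric_sums[of "1/2::real"], of "?f 11"] by simp
  have "(\<Sum>k. ?f (k + 11)) \<le> (\<Sum>k. ?f 11 * (1 / 2) ^ k)"
    using bh_term_le[of 11] by (intro suminf_le sm sums_summable[OF geo]) auto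
  also have "\<dots> = ?f 11 * 2" by (rule sums_unique[OF geo, symmetric])
  finally have up: "(\<Sum>k. ?f (k + 11)) \<le> 2 / 367873228800" by (simp add: bh_fact_values)
  have lo: "(\<Sum>k. ?f (k + 11)) \<ge> 0" by (intro suminf_nonneg sm) auto
  have "(\<Sum>n<11. ?f n) = 1 + 1 + 1/2 + 1/24 + 1/48 + 1/5760 + 1/11520 + 1/2903040 + 1/5806080
      + 1/1393459200 + 1/2786918400"
  proof -
    have "{..<11::nat} = {0, 1, 2, 3, 4, 5, 6, 7, 8, 9, 10}"
      unfolding set_eq_iff lessThan_iff insert_iff empty_iff by presburger
    then show ?thesis using bh_fact_values by (simp only:) simp
  qed
  then show ?thesis using split up lo by (simp add: abs_less_iff)
qed

end

theory Submission
  imports Defs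
begin

text \<open>The factorials divide one another successively, so if the sum were \<open>a / q\<close>, then
  \<open>q * n!\<close> times the tail beyond \<open>n\<close> would be a positive integer for every \<open>n\<close>. But the quotient
  \<open>(n + 1)! / n!\<close> is divisible by \<open>2 * n\<close> when \<open>n\<close> is a power of 2, which makes this number
  at most \<open>q / n\<close>.\<close>

text \<open>Each prime's exponent is monotone in \<open>n\<close>. Writing both factorials over the
  primes up to \<open>Suc n\<close> lets them be compared factor by factor.\<close>

lemma bh_fact_dvd_Suc: "bh_fact n dvd bh_fact (Suc n)"
proof (cases "n = 0")
  case False
  then have n: "n \<ge> 1" by simp
  have "(\<Prod>p \<in> {p \<in> {..Suc n}. prime p}. p ^ bh_exponent n p)
      dvd (\<Prod>p \<in> {p \<in> {..Suc n}. prime p}. p ^ bh_exponent (Suc n) p)"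
    using bh_exponent_mono[OF n] by (intro prod_dvd_prod le_imp_power_dvd) auto
  then show ?thesis
    using bh_fact_eq[OF n, of "Suc n"] bh_fact_eq[of "Suc n" "Suc n"] by simp
qed (simp add: bh_fact_def)

lemma bh_fact_dvd:
  assumes "m \<le> n"
  shows "bh_fact m dvd bh_fact n"
  using assms
proof (induction rule: dec_induct)
  case (step n)
  then show ?case using bh_fact_dvd_Suc dvd_trans by blast
qed simp

text \<open>For the prime 2 the exponents of \<open>n\<close> and \<open>Suc n\<close> are sums of
  \<open>(n - 1) div 2 ^ m\<close> and \<open>n div 2 ^ m\<close>. As \<open>n = 2 ^ j\<close> is a
  multiple of \<open>2 ^ m\<close> for each \<open>m \<le> j\<close>, these \<open>j + 1\<close>
  quotients all jump by one.\<close>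

lemma bh_exponent_2_power2:
  "bh_exponent (2 ^ j) 2 + Suc j \<le> bh_exponent (Suc (2 ^ j)) 2"
proof -
  define n :: nat where "n = 2 ^ j"
  \<comment> \<open>All jumping indices \<open>m \<le> j\<close> thus lie in the summation range
    \<open>{..<n}\<close>.\<close>
  have jn: "j < n" unfolding n_def by (rule less_exp)
  have step: "(n - 1) div 2 ^ m + (if m \<le> j then 1 else 0) \<le> n div 2 ^ m" for m
  proof (cases "m \<le> j")
    case True
    have n: "n = 2 ^ (j - m) * 2 ^ m"
      using True by (simp add: n_def flip: power_add)
    have "(n - 1) div 2 ^ m < 2 ^ (j - m)"
      using jn n by (intro less_mult_imp_div_less) simp
    moreover have "n div 2 ^ m = 2 ^ (j - m)"
      by (subst n) simp
    ultimately show ?thesis using True by simp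
  qed (simp add: div_le_mono)
  have "bh_exponent n 2 + Suc j
      = (\<Sum>m<n. (n - 1) div 2 ^ m) + (\<Sum>m\<in>{..<n} \<inter> {..j}. 1)"
  proof -
    have "{..<n} \<inter> {..j} = {..j}" using jn by auto
    then show ?thesis using bh_exponent_eq[of n 2] jn by simp
  qed
  also have "\<dots> = (\<Sum>m<n. (n - 1) div 2 ^ m + (if m \<le> j then 1 else 0))"
    unfolding sum.distrib by (subst sum.inter_restrict) simp_all
  also have "\<dots> \<le> (\<Sum>m<n. n div 2 ^ m)"
    by (intro sum_mono step)
  also have "\<dots> \<le> (\<Sum>m<Suc n. n div 2 ^ m)"
    by (intro sum_mono2) auto
  also have "\<dots> = bh_exponent (Suc n) 2"
    using bh_exponent_eq[of "Suc n" 2] by simp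
  finally show ?thesis unfolding n_def .
qed

text \<open>The exponents of the odd primes do not decrease, so a gain at the prime 2 carries over
  to the whole factorial.\<close>

lemma bh_fact_Suc_ge_exponent_2:
  assumes "n \<ge> 1" "bh_exponent n 2 + k \<le> bh_exponent (Suc n) 2"
  shows "2 ^ k * bh_fact n \<le> bh_fact (Suc n)"
proof -
  define P where "P = {p \<in> {..Suc n}. prime p} - {2::nat}"
  have P: "{p \<in> {..Suc n}. prime p} = insert 2 P" "2 \<notin> P" "finite P"
    using assms(1) by (auto simp: P_def)
  have "2 ^ k * bh_fact n = 2 ^ (bh_exponent n 2 + k) * (\<Prod>p\<in>P. p ^ bh_exponent n p)"
    using bh_fact_eq[OF assms(1), of "Suc n"] P by (simp add: power_add)
  also have "\<dots> \<le> 2 ^ bh_exponent (Suc n) 2 * (\<Prod>p\<in>P. p ^ bh_exponent (Suc n) p)"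
  proof (intro mult_mono prod_mono)
    show "(2::nat) ^ (bh_exponent n 2 + k) \<le> 2 ^ bh_exponent (Suc n) 2"
      using assms(2) by (intro power_increasing) auto
  next
    fix p assume "p \<in> P"
    then have "prime p" by (auto simp: P_def)
    then show "0 \<le> p ^ bh_exponent n p \<and> p ^ bh_exponent n p \<le> p ^ bh_exponent (Suc n) p"
      using bh_exponent_mono[OF assms(1)] prime_ge_1_nat by (auto intro!: power_increasing)
  qed auto
  also have "\<dots> = bh_fact (Suc n)"
    using bh_fact_eq[of "Suc n" "Suc n"] P by simp
  finally show ?thesis .
qed

lemma bh_tail_summable: "summable (\<lambda>k. 1 / real (bh_fact (k + n)))"
  using bh_e_summable by (simp only: summable_iff_shift[of "\<lambda>n. 1 / real (bh_fact n)" n])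

lemma bh_tail_pos: "(\<Sum>k. 1 / real (bh_fact (k + n))) > 0"
  using bh_fact_pos by (intro suminf_pos bh_tail_summable) simp

text \<open>The factorials at least double at each step, so a geometric series of ratio 1/2
  dominates the tail.\<close>

lemma bh_tail_le:
  assumes "n \<ge> 1"
  shows "(\<Sum>k. 1 / real (bh_fact (k + n))) \<le> 2 / real (bh_fact n)"
proof -
  have geo: "(\<lambda>k. 1 / real (bh_fact n) * (1 / 2) ^ k) sums (1 / real (bh_fact n) * 2)"
    using sums_mult[OF geometric_sums[of "1/2::real"], of "1 / real (bh_fact n)"] by simp
  have "(\<Sum>k. 1 / real (bh_fact (k + n))) \<le> (\<Sum>k. 1 / real (bh_fact n) * (1 / 2) ^ k)"
    by (intro suminf_le bh_term_le[OF assms] bh_tail_summable sums_summable[OF geo])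
  also have "\<dots> = 2 / real (bh_fact n)"
    using sums_unique[OF geo] by simp
  finally show ?thesis .
qed

lemma bh_fact_times_partial_sum_Ints:
  "real (bh_fact n) * (\<Sum>k<Suc n. 1 / real (bh_fact k)) \<in> \<int>"
  unfolding sum_distrib_left
proof (intro Ints_sum)
  fix k assume "k \<in> {..<Suc n}"
  then obtain c where "bh_fact n = bh_fact k * c"
    using bh_fact_dvd[of k n] by (auto elim: dvdE)
  then show "real (bh_fact n) * (1 / real (bh_fact k)) \<in> \<int>"
    using bh_fact_pos[of k] by simp
qed

theorem corollary26: "bh_e \<notin> \<rat>"
proof
  assume "bh_e \<in> \<rat>"
  then obtain a :: int and q :: nat where q: "q > 0" and e: "bh_e = of_int a / real q"
    by (elim Rats_cases') (metis nat_0_le of_int_of_nat_eq of_nat_0_less_iff order_less_imp_le)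
  \<comment> \<open>A power of 2 gives the large jump from \<open>bh_fact n\<close> to
    \<open>bh_fact (Suc n)\<close>; the exponent \<open>q\<close> ensures
    \<open>q < n\<close>.\<close>
  define n :: nat where "n = 2 ^ q"
  define t where "t = (\<Sum>k. 1 / real (bh_fact (k + Suc n)))"
  let ?x = "real q * real (bh_fact n) * t"
  have n: "n \<ge> 1" by (simp add: n_def)
  have split: "bh_e = t + (\<Sum>k<Suc n. 1 / real (bh_fact k))"
    unfolding bh_e_def t_def by (rule suminf_split_initial_segment[OF bh_e_summable])
  have "?x = real (bh_fact n) * of_int a
      - real q * (real (bh_fact n) * (\<Sum>k<Suc n. 1 / real (bh_fact k)))"
  proof -
    have a: "of_int a = real q * bh_e" unfolding e using q by simp
    show ?thesis unfolding a split by (simp only: algebra_simps)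
  qed
  then have int: "?x \<in> \<int>"
    using bh_fact_times_partial_sum_Ints[of n] by simp
  have pos: "?x > 0"
    using q bh_fact_pos[of n] bh_tail_pos[of "Suc n"] by (simp add: t_def)
  have "bh_exponent n 2 + Suc q \<le> bh_exponent (Suc n) 2"
    unfolding n_def by (rule bh_exponent_2_power2)
  then have "2 ^ Suc q * bh_fact n \<le> bh_fact (Suc n)"
    by (rule bh_fact_Suc_ge_exponent_2[OF n])
  then have "2 * (n * bh_fact n) \<le> bh_fact (Suc n)"
    by (simp add: n_def)
  then have growth: "2 * (real n * real (bh_fact n)) \<le> real (bh_fact (Suc n))"
    by (metis of_nat_le_iff of_nat_mult of_nat_numeral)
  \<comment> \<open>The factor 2 in \<open>growth\<close> cancels the 2 of the geometric tail
    bound.\<close>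
  have "real n * real (bh_fact n) * t \<le> real n * real (bh_fact n) * (2 / real (bh_fact (Suc n)))"
    unfolding t_def by (intro mult_left_mono bh_tail_le) auto
  also have "\<dots> \<le> 1"
    using growth bh_fact_pos[of "Suc n"] by (simp add: divide_simps mult_ac)
  finally have le: "real n * real (bh_fact n) * t \<le> 1" .
  have "q < n" unfolding n_def by (rule less_exp)
  \<comment> \<open>Strictness comes from \<open>q < n\<close> together with \<open>t > 0\<close>;
    it places the integer \<open>?x\<close> strictly between 0 and 1.\<close>
  then have "?x < real n * real (bh_fact n) * t"
    using bh_fact_pos[of n] bh_tail_pos[of "Suc n"]
    by (intro mult_strict_right_mono) (simp_all add: t_def)
  with le have "?x < 1" by simp
  with int pos show False
    by (metis Ints_cases of_int_0_less_iff of_int_less_1_iff int_one_le_iff_zero_less not_less)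
qed

end
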